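(* Let $k\ge 1$, let $\Omega\subset\mathbb{R}^2$ be open and convex, and let $A\in C^k(\Omega,\mathbb{C}^{2\times 2})$. Let $\xi_0\in\Omega$ be a generic cuspidal point (GCP) of $A$, and suppose that $A(\xi)$ has distinct eigenvalues for every $\xi\in\Omega\setminus\{\xi_0\}$. Let $\Gamma\subset\Omega$ be a Jordan curve encircling $\xi_0$, parametrized by $\gamma$ in such a way that both $\gamma(\cdot)$ and $A(\gamma(\cdot))$ are $1$-periodic. Let $\lambda_1,\lambda_2:\mathbb{R}\to\mathbb{C}$ be a continuous labeling of the eigenvalues of $A(\gamma(t))$, i.e. $\lambda_1,\lambda_2$ are continuous and $\lambda_1(t),\lambda_2(t)$ are the eigenvalues of $A(\gamma(t))$ for every $t\in\mathbb{R}$. Then, for all $t\in\mathbb{R}$, $$\lambda_1(t+1)=\lambda_2(t)\quad\text{and}\quad \lambda_2(t+1)=\lambda_1(t).$$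
   Context: GCP for $2\times2$ functions: write $A(\xi)=\begin{bmatrix} a(\xi)&b(\xi)\\ c(\xi)&d(\xi)\end{bmatrix}$, $\Delta(\xi)=(a(\xi)-d(\xi))^2+4b(\xi)c(\xi)$ and $F(\xi)=(\mathrm{Re}\,\Delta(\xi),\mathrm{Im}\,\Delta(\xi))\in\mathbb{R}^2$. A point $\xi_0\in\Omega$ is a generic cuspidal point (GCP) of $A$ if $F(\xi_0)=0$ and the Jacobian $DF(\xi_0)\in\mathbb{R}^{2\times 2}$ is invertible. Periodicity convention: "$p$-periodic" means that $p$ is the minimal positive period. Jordan curve: a continuous $1$-periodic map $\gamma:\mathbb{R}\to\mathbb{R}^2$ that is one-to-one on $[0,1)$; its image $\Gamma=\gamma([0,1))$ is also called a Jordan curve. $\Gamma$ encircles a point if the point lies in the bounded component of $\mathbb{R}^2\setminus\Gamma$. *)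

theory Defs
  imports "HOL-Analysis.Analysis"
begin

(* On an open set S of a finite-dimensional space this is the usual class C^k: all iterated
   directional derivatives up to order k exist as Frechet derivatives and are continuous. *)
primrec Ck_on ::
  "nat \<Rightarrow> 'a::real_normed_vector set \<Rightarrow> ('a \<Rightarrow> 'b::real_normed_vector) \<Rightarrow> bool" where
  "Ck_on 0 S f \<longleftrightarrow> continuous_on S f"
| "Ck_on (Suc k) S f \<longleftrightarrow>
     (\<forall>x\<in>S. f differentiable (at x)) \<and>
     (\<forall>v. Ck_on k S (\<lambda>x. frechet_derivative f (at x) v))"

definition eigenvalues :: "complex^'n^'n \<Rightarrow> complex set" where
  "eigenvalues M = {\<mu>. \<exists>v. v \<noteq> 0 \<and> M *v v = \<mu> *s v}"

definition Delta :: "complex^2^2 \<Rightarrow> complex" where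
  "Delta M = (M$1$1 - M$2$2)\<^sup>2 + 4 * (M$1$2) * (M$2$1)"

definition F_map :: "(real^2 \<Rightarrow> complex^2^2) \<Rightarrow> real^2 \<Rightarrow> real^2" where
  "F_map A \<xi> = vector [Re (Delta (A \<xi>)), Im (Delta (A \<xi>))]"

definition generic_cuspidal_point ::
  "(real^2) set \<Rightarrow> (real^2 \<Rightarrow> complex^2^2) \<Rightarrow> real^2 \<Rightarrow> bool" where
  "generic_cuspidal_point \<Omega> A \<xi>\<^sub>0 \<longleftrightarrow>
     \<xi>\<^sub>0 \<in> \<Omega> \<and> F_map A \<xi>\<^sub>0 = 0 \<and> invertible (jacobian (F_map A) (at \<xi>\<^sub>0))"

(* p is the minimal positive period, so constant functions are not periodic. *)
definition periodic_with :: "real \<Rightarrow> (real \<Rightarrow> 'a) \<Rightarrow> bool" where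
  "periodic_with p f \<longleftrightarrow>
     0 < p \<and> (\<forall>t. f (t + p) = f t) \<and> (\<forall>q. 0 < q \<and> q < p \<longrightarrow> \<not> (\<forall>t. f (t + q) = f t))"

definition jordan_curve :: "(real \<Rightarrow> real^2) \<Rightarrow> bool" where
  "jordan_curve \<gamma> \<longleftrightarrow>
     continuous_on UNIV \<gamma> \<and> periodic_with 1 \<gamma> \<and> inj_on \<gamma> {0..<1}"

(* The library's inside S is the union of the bounded components of the complement of S. *)
definition encircles :: "(real \<Rightarrow> real^2) \<Rightarrow> real^2 \<Rightarrow> bool" where
  "encircles \<gamma> x \<longleftrightarrow> x \<in> inside (\<gamma> ` {0..<1})"

end

theory Submission
  imports Defs "HOL-Complex_Analysis.Riemann_Mapping"
begin

text \<open>The labels satisfy \<open>(\<lambda>\<^sub>1 - \<lambda>\<^sub>2)\<^sup>2 = \<Delta> \<circ> A \<circ> \<gamma>\<close>. If \<open>L\<close> denotes the derivative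
  of \<open>\<Delta> \<circ> A\<close> at \<open>\<xi>\<^sub>0\<close>, then \<open>\<Delta> (A \<xi>) / L (\<xi> - \<xi>\<^sub>0)\<close> tends to \<open>1\<close> at \<open>\<xi>\<^sub>0\<close>, so it extends to
  a continuous zero-free function on the convex set \<open>\<Omega>\<close> and has a continuous square root \<open>s\<close>.
  Hence \<open>(\<lambda>\<^sub>1 - \<lambda>\<^sub>2) / (s \<circ> \<gamma>)\<close> is a continuous square root of \<open>L (\<gamma> - \<xi>\<^sub>0)\<close>, a Jordan curve
  around \<open>0\<close>. Its winding number is \<open>\<plusminus>1\<close>, so the square root changes sign along one turn.\<close>

section \<open>Encirclement and winding of Jordan curves\<close>

text \<open>The inverse \<open>f'\<close> maps the component of \<open>f z\<close> into the bounded
  component of \<open>z\<close>. The closure of the latter is compact, so its image under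
  \<open>f\<close> is bounded and contains the component of \<open>f z\<close>. This moves
  encirclement through an affine change of coordinates.\<close>

lemma inside_homeomorphic_image:
  fixes f :: "'a::heine_borel \<Rightarrow> 'b::heine_borel"
  assumes f: "homeomorphism UNIV UNIV f f'" and z: "z \<in> inside S"
  shows "f z \<in> inside (f ` S)"
proof -
  define C where "C = connected_component_set (- f ` S) (f z)"
  have ff': "f (f' y) = y" "f' (f x) = x" for x y
    using f by (auto simp: homeomorphism_def)
  have cont: "continuous_on UNIV f" "continuous_on UNIV f'"
    using f by (auto simp: homeomorphism_def)
  have zS: "z \<notin> S" and bd: "bounded (connected_component_set (- S) z)"
    using z by (auto simp: inside_def)
  have fz: "f z \<notin> f ` S"
    using zS ff'(2) by (metis imageE)
  have sub: "f' ` C \<subseteq> connected_component_set (- S) z"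
  proof (rule connected_component_maximal)
    show "z \<in> f' ` C"
      using fz ff' by (metis C_def ComplI connected_component_refl image_eqI mem_Collect_eq)
    show "connected (f' ` C)"
      unfolding C_def
      by (intro connected_continuous_image continuous_on_subset[OF cont(2)]) auto
    have "C \<subseteq> - f ` S"
      by (simp add: C_def connected_component_subset)
    then show "f' ` C \<subseteq> - S"
      using ff' by (metis ComplD ComplI image_eqI image_subset_iff subsetD)
  qed
  have "bounded (f ` closure (connected_component_set (- S) z))"
    using bd by (intro compact_imp_bounded compact_continuous_image continuous_on_subset[OF cont(1)])
      (auto simp: compact_closure)
  then have "bounded (f ` f' ` C)"
    by (rule bounded_subset) (use sub closure_subset in blast)
  then show ?thesis
    using fz by (simp add: inside_def C_def image_image ff')
qed

text \<open>A continuous logarithm \<open>l\<close> of \<open>p\<close> gains plus or minus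
  \<open>2 * pi * \<i>\<close> along the curve, so the particular root \<open>exp (l t / 2)\<close>
  changes sign. Any other continuous root \<open>q\<close> differs from it by a continuous factor
  with values in \<open>{1, -1}\<close>, which is constant.\<close>

lemma sqrt_along_jordan_curve_changes_sign:
  fixes p q :: "real \<Rightarrow> complex"
  assumes p: "simple_path p" and "0 \<in> inside (path_image p)"
    and q: "continuous_on {0..1} q" and pq: "\<And>t. t \<in> {0..1} \<Longrightarrow> p t = (q t)\<^sup>2"
  shows "q 1 = - q 0"
proof -
  have 0: "0 \<notin> path_image p"
    using assms(2) by (simp add: inside_def)
  obtain l where l: "path l"
      "pathfinish l - pathstart l = 2 * of_real pi * \<i> * winding_number p 0"
      "\<And>t. t \<in> {0..1} \<Longrightarrow> p t = 0 + exp (l t)"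
    using winding_number_as_continuous_log[OF simple_path_imp_path[OF p] 0] by blast
  have q0: "q t \<noteq> 0" if "t \<in> {0..1}" for t
    using that l(3)[of t] pq[of t] by auto
  define r where "r t = exp (l t / 2) / q t" for t
  have cont_r: "continuous_on {0..1} r"
    unfolding r_def using l(1) q q0 by (auto intro!: continuous_intros simp: path_def)
  have "(r t)\<^sup>2 = 1" if "t \<in> {0..1}" for t
  proof -
    have "(exp (l t / 2))\<^sup>2 = exp (l t)"
      by (simp flip: exp_double)
    then show ?thesis
      using that l(3)[of t] pq[of t] q0[of t] by (simp add: r_def power_divide)
  qed
  then have "r ` {0..1} \<subseteq> {1, -1}"
    by (force simp: power2_eq_1_iff)
  then have "finite (r ` {0..1})"
    by (rule finite_subset) simp
  then have "r constant_on {0..1}"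
    by (intro continuous_finite_range_constant cont_r) auto
  then have r: "r 1 = r 0"
    by (auto simp: constant_on_def)
  have "winding_number p 0 = 1 \<or> winding_number p 0 = -1"
    using simple_closed_path_winding_number_inside[OF p] assms(2) by metis
  then have "l 1 = l 0 + 2 * of_real pi * \<i> \<or> l 1 = l 0 - 2 * of_real pi * \<i>"
    using l(2) by (auto simp: pathfinish_def pathstart_def algebra_simps)
  then have "l 1 / 2 = l 0 / 2 + of_real pi * \<i> \<or> l 1 / 2 = l 0 / 2 - of_real pi * \<i>"
    by (auto simp: field_simps)
  \<comment> \<open>Half of a full turn is a shift by \<open>pi * \<i>\<close> in either direction,
    and both give the factor \<open>-1\<close>.\<close>
  then have "exp (l 1 / 2) = - exp (l 0 / 2)"
    by (elim disjE) (simp_all only: exp_add exp_diff, simp_all)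
  with r have "exp (l 0 / 2) * q 1 = exp (l 0 / 2) * - q 0"
    using q0[of 0] q0[of 1] by (simp add: r_def field_simps)
  then show ?thesis
    by (simp only: mult_cancel_left exp_not_eq_zero simp_thms)
qed

section \<open>Eigenvalues and discriminant of a 2x2 matrix\<close>

lemma eigenvalue_char_poly_2:
  fixes M :: "complex^2^2"
  assumes "\<mu> \<in> eigenvalues M"
  shows "(M$1$1 - \<mu>) * (M$2$2 - \<mu>) = M$1$2 * M$2$1"
proof -
  obtain v where v: "v \<noteq> 0" "M *v v = \<mu> *s v"
    using assms by (auto simp: eigenvalues_def)
  have e1: "M$1$1 * v$1 + M$1$2 * v$2 = \<mu> * v$1" and e2: "M$2$1 * v$1 + M$2$2 * v$2 = \<mu> * v$2"
    using v(2) by (simp_all add: vec_eq_iff forall_2 matrix_vector_mult_def sum_2)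
  have "v$1 \<noteq> 0 \<or> v$2 \<noteq> 0"
    using v(1) by (auto simp: vec_eq_iff forall_2)
  \<comment> \<open>Eliminating one coordinate from \<open>e1\<close> and \<open>e2\<close> leaves
    the characteristic determinant times the other coordinate.\<close>
  moreover have "((M$1$1 - \<mu>) * (M$2$2 - \<mu>) - M$1$2 * M$2$1) * v$1 = 0"
    using e1 e2 by algebra
  moreover have "((M$1$1 - \<mu>) * (M$2$2 - \<mu>) - M$1$2 * M$2$1) * v$2 = 0"
    using e1 e2 by algebra
  ultimately show ?thesis
    by auto
qed

text \<open>Subtracting the two characteristic equations and cancelling \<open>\<mu> - \<nu>\<close>
  identifies the trace as \<open>\<mu> + \<nu>\<close>; the rest is the usual formula for the
  discriminant of a quadratic.\<close>

lemma Delta_eq_eigenvalue_diff_sq: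
  assumes "eigenvalues M = {\<mu>, \<nu>}" "\<mu> \<noteq> \<nu>"
  shows "Delta M = (\<mu> - \<nu>)\<^sup>2"
proof -
  have \<mu>: "(M$1$1 - \<mu>) * (M$2$2 - \<mu>) = M$1$2 * M$2$1"
    and \<nu>: "(M$1$1 - \<nu>) * (M$2$2 - \<nu>) = M$1$2 * M$2$1"
    using assms by (auto intro!: eigenvalue_char_poly_2)
  then have "(\<mu> - \<nu>) * (M$1$1 + M$2$2 - \<mu> - \<nu>) = 0"
    by algebra
  then have "M$1$1 + M$2$2 - \<mu> - \<nu> = 0"
    using assms(2) by simp
  with \<mu> show ?thesis
    unfolding Delta_def by algebra
qed

lemma differentiable_F_map:
  assumes A: "A differentiable (at \<xi>)"
  shows "F_map A differentiable (at \<xi>)"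
proof -
  obtain A' where A': "(A has_derivative A') (at \<xi>)"
    using A by (auto simp: differentiable_def)
  have entry: "((\<lambda>x. A x $ i $ j) has_derivative (\<lambda>h. A' h $ i $ j)) (at \<xi>)" for i j
    by (intro bounded_linear.has_derivative[OF bounded_linear_vec_nth] A')
  have "\<exists>D. ((\<lambda>x. Delta (A x)) has_derivative D) (at \<xi>)"
    unfolding Delta_def by (rule exI, (rule derivative_eq_intros entry refl)+)
  then obtain D where D: "((\<lambda>x. Delta (A x)) has_derivative D) (at \<xi>)" ..
  \<comment> \<open>Expansion in the standard basis brings the vector-valued map into a form that
    the derivative rules handle.\<close>
  have F: "F_map A = (\<lambda>x. Re (Delta (A x)) *\<^sub>R axis 1 1 + Im (Delta (A x)) *\<^sub>R axis 2 1)"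
    by (auto simp: F_map_def fun_eq_iff vec_eq_iff forall_2 axis_def)
  have "(F_map A has_derivative (\<lambda>h. Re (D h) *\<^sub>R axis 1 1 + Im (D h) *\<^sub>R axis 2 1)) (at \<xi>)"
    unfolding F by (auto intro!: derivative_eq_intros D)
  then show ?thesis
    by (auto simp: differentiable_def)
qed

section \<open>Square root of a function divided by its linearization\<close>

text \<open>The error \<open>D y - L (y - x)\<close> is small compared with
  \<open>norm (y - x)\<close>, and the lower bound \<open>B\<close> makes it small compared with
  \<open>L (y - x)\<close> as well.\<close>

lemma tendsto_quotient_linearization:
  fixes D :: "'a::euclidean_space \<Rightarrow> 'b::real_normed_field"
  assumes D: "(D has_derivative L) (at x)" and "D x = 0"
    and B: "B > 0" "\<And>v. B * norm v \<le> norm (L v)"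
  shows "((\<lambda>y. D y / L (y - x)) \<longlongrightarrow> 1) (at x)"
proof -
  have lim: "((\<lambda>y. norm (D y - L (y - x)) / norm (y - x) / B) \<longlongrightarrow> 0) (at x)"
    using tendsto_divide[OF conjunct2[OF D[unfolded has_derivative_iff_norm]] tendsto_const, of B]
    by (simp add: \<open>D x = 0\<close> B(1)[THEN less_imp_neq, symmetric])
  have "((\<lambda>y. D y / L (y - x) - 1) \<longlongrightarrow> 0) (at x)"
  proof (rule Lim_null_comparison[OF _ lim], unfold eventually_at_filter, intro always_eventually allI impI)
    fix y assume "y \<noteq> x"
    then have n: "norm (y - x) > 0" by simp
    then have "norm (L (y - x)) > 0"
      using B by (smt (verit) mult_pos_pos)
    then have "D y / L (y - x) - 1 = (D y - L (y - x)) / L (y - x)"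
      by (auto simp: field_simps)
    also have "norm \<dots> \<le> norm (D y - L (y - x)) / (B * norm (y - x))"
      unfolding norm_divide using B n by (intro divide_left_mono) (auto intro!: mult_pos_pos \<open>norm (L (y - x)) > 0\<close>)
    finally show "norm (D y / L (y - x) - 1) \<le> norm (D y - L (y - x)) / norm (y - x) / B"
      by (simp add: mult.commute)
  qed
  then show ?thesis
    by (simp add: LIM_zero_cancel)
qed

text \<open>The zeros of \<open>D\<close> and of its linearization at \<open>x\<close> cancel, so
  the quotient extends to a zero-free continuous function on \<open>S\<close>. Convexity makes
  \<open>S\<close> contractible, hence this function has a continuous square root.\<close>

lemma sqrt_of_quotient_by_linearization:
  fixes D :: "'a::euclidean_space \<Rightarrow> complex"
  assumes S: "open S" "convex S" "x \<in> S" and cont: "continuous_on S D"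
    and D: "(D has_derivative L) (at x)" and inj: "inj L"
    and nz: "\<And>y. y \<in> S \<Longrightarrow> D y = 0 \<longleftrightarrow> y = x"
  obtains s where "continuous_on S s" "\<And>y. y \<in> S \<Longrightarrow> s y \<noteq> 0"
    "\<And>y. y \<in> S \<Longrightarrow> D y = (s y)\<^sup>2 * L (y - x)"
proof -
  have lin: "linear L"
    using D by (rule has_derivative_linear)
  obtain B where B: "B > 0" "\<And>v. B * norm v \<le> norm (L v)"
    using linear_inj_bounded_below_pos[OF lin inj] by blast
  have L0: "L v = 0 \<longleftrightarrow> v = 0" for v
    using inj lin by (metis injD linear_0)
  define h where "h y = (if y = x then 1 else D y / L (y - x))" for y
  have "isCont h y" if "y \<in> S" for y
  proof (cases "y = x")
    case True
    have "(h \<longlongrightarrow> 1) (at x)"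
      using tendsto_quotient_linearization[OF D _ B] nz S(3)
      by (subst filterlim_cong[OF refl refl, of h "\<lambda>y. D y / L (y - x)"])
        (auto simp: h_def eventually_at_filter)
    then show ?thesis
      by (simp add: True isCont_def h_def)
  next
    case False
    have "isCont D y"
      using cont S(1) that by (simp add: continuous_on_eq_continuous_at)
    moreover have "isCont (\<lambda>y. L (y - x)) y"
      using bounded_linear.isCont[OF linear_conv_bounded_linear[THEN iffD1, OF lin], of y "\<lambda>y. y - x"] by simp
    ultimately have "isCont (\<lambda>y. D y / L (y - x)) y"
      using False L0 by (intro continuous_intros) auto
    moreover have "\<forall>\<^sub>F z in nhds y. h z = D z / L (z - x)"
      using t1_space_nhds[OF False] by (rule eventually_mono) (simp add: h_def)
    ultimately show ?thesis
      by (simp add: isCont_cong)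
  qed
  then have "continuous_on S h"
    by (simp add: continuous_at_imp_continuous_on)
  moreover have h0: "h y \<noteq> 0" if "y \<in> S" for y
    using that nz L0 by (simp add: h_def)
  ultimately obtain s where s: "continuous_on S s" "\<And>y. y \<in> S \<Longrightarrow> h y = (s y)\<^sup>2"
    using continuous_sqrt_on_contractible[OF _ convex_imp_contractible[OF S(2)]] by blast
  show thesis
  proof
    show "continuous_on S s" by fact
    show "s y \<noteq> 0" if "y \<in> S" for y
      using h0[OF that] s(2)[OF that] by auto
    show "D y = (s y)\<^sup>2 * L (y - x)" if "y \<in> S" for y
      \<comment> \<open>At \<open>y = x\<close> both sides vanish, so the factorization includes the
        centre.\<close>
      using s(2)[OF that] nz[OF that] L0 linear_0[OF lin] by (auto simp: h_def field_simps split: if_splits)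
  qed
qed

section \<open>Periodic Jordan curves as simple closed paths\<close>

lemma jordan_curve_image:
  assumes "jordan_curve \<gamma>"
  shows "\<gamma> t \<in> \<gamma> ` {0..<1}" "path_image \<gamma> = \<gamma> ` {0..<1}"
proof -
  have per: "\<gamma> (t + 1) = \<gamma> t" for t
    using assms by (simp add: jordan_curve_def periodic_with_def)
  have nat: "\<gamma> (t + real n) = \<gamma> t" for t n
    by (induction n) (auto simp: add.assoc[symmetric] add.commute[of 1] per)
  \<comment> \<open>Since \<open>nat\<close> shifts forwards, a nonnegative \<open>t\<close> is
    reached from \<open>frac t\<close>, while a negative \<open>t\<close> is itself moved up to
    \<open>frac t\<close>.\<close>
  have "\<gamma> (frac t) = \<gamma> t" for t
  proof (cases "\<lfloor>t\<rfloor> \<ge> 0")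
    case True
    then show ?thesis
      using nat[of "frac t" "nat \<lfloor>t\<rfloor>"] by (simp add: frac_def)
  next
    case False
    then show ?thesis
      using nat[of t "nat (- \<lfloor>t\<rfloor>)"] by (simp add: frac_def)
  qed
  then show *: "\<gamma> t \<in> \<gamma> ` {0..<1}" for t
    by (metis atLeastLessThan_iff frac_ge_0 frac_lt_1 imageI)
  show "path_image \<gamma> = \<gamma> ` {0..<1}"
    using * by (fastforce simp: path_image_def)
qed

lemma jordan_curve_simple_path:
  assumes "jordan_curve \<gamma>"
  shows "simple_path \<gamma>"
proof -
  have g: "\<gamma> 1 = \<gamma> 0"
    using assms by (metis add_0 jordan_curve_def periodic_with_def)
  have "loop_free \<gamma>"
    unfolding loop_free_def
  proof (intro ballI impI)
    fix x y :: real assume xy: "x \<in> {0..1}" "y \<in> {0..1}" "\<gamma> x = \<gamma> y"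
    have inj: "\<gamma> u = \<gamma> v \<Longrightarrow> u = v" if "u \<in> {0..<1}" "v \<in> {0..<1}" for u v
      using assms that by (auto simp: jordan_curve_def inj_on_def)
    show "x = y \<or> x = 0 \<and> y = 1 \<or> x = 1 \<and> y = 0"
    proof (cases "x = 1"; cases "y = 1")
      assume "x = 1" "y \<noteq> 1"
      moreover from this have "0 = y"
        using xy g by (intro inj) auto
      ultimately show ?thesis by simp
    next
      assume "x \<noteq> 1" "y = 1"
      moreover from this have "x = 0"
        using xy g by (intro inj) auto
      ultimately show ?thesis by simp
    next
      assume "x \<noteq> 1" "y \<noteq> 1"
      then have "x = y"
        using xy by (intro inj) auto
      then show ?thesis ..
    qed simp
  qed
  then show ?thesis
    using assms by (auto simp: simple_path_def path_def jordan_curve_def intro: continuous_on_subset)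
qed

section \<open>Exchange of the eigenvalue labels after one turn\<close>

theorem theorem2p8:
  fixes k :: nat
    and \<Omega> :: "(real^2) set"
    and A :: "real^2 \<Rightarrow> complex^2^2"
    and \<xi>\<^sub>0 :: "real^2"
    and \<gamma> :: "real \<Rightarrow> real^2"
    and lam1 lam2 :: "real \<Rightarrow> complex"
  assumes "k \<ge> 1"
    and "open \<Omega>" and "convex \<Omega>"
    and "Ck_on k \<Omega> A"
    and "generic_cuspidal_point \<Omega> A \<xi>\<^sub>0"
    and "\<forall>\<xi>\<in>\<Omega> - {\<xi>\<^sub>0}. card (eigenvalues (A \<xi>)) = 2"
    and "jordan_curve \<gamma>"
    and "\<gamma> ` {0..<1} \<subseteq> \<Omega>"
    and "encircles \<gamma> \<xi>\<^sub>0"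
    and "periodic_with 1 (\<lambda>t. A (\<gamma> t))"
    and "continuous_on UNIV lam1" and "continuous_on UNIV lam2"
    and "\<forall>t. eigenvalues (A (\<gamma> t)) = {lam1 t, lam2 t}"
  shows "\<forall>t. lam1 (t + 1) = lam2 t \<and> lam2 (t + 1) = lam1 t"
proof -
  define D where "D \<xi> = Delta (A \<xi>)" for \<xi>
  \<comment> \<open>The identification of the plane with the complex numbers turns
    \<open>F_map A\<close> into \<open>D\<close> and the Jacobian \<open>J\<close> into a
    real-linear bijection \<open>L\<close>.\<close>
  define c :: "real^2 \<Rightarrow> complex" where "c v = Complex (v$1) (v$2)" for v
  define J where "J = jacobian (F_map A) (at \<xi>\<^sub>0)"
  define L where "L = (\<lambda>h. c (J *v h))"
  have gcp: "\<xi>\<^sub>0 \<in> \<Omega>" "F_map A \<xi>\<^sub>0 = 0" "invertible J"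
    using assms(5) by (auto simp: generic_cuspidal_point_def J_def)
  have Adiff: "A differentiable (at \<xi>)" if "\<xi> \<in> \<Omega>" for \<xi>
    using assms(1,4) that by (cases k) auto
  have lin_c: "linear c"
    by (rule linearI) (auto simp: c_def complex_eq_iff)
  have bij_c: "bij c"
    by (rule bijI) (auto simp: c_def inj_def vec_eq_iff forall_2 surj_def complex_eq_iff
        intro!: exI[of _ "vector [Re _, Im _]"])
  have cF: "D = (\<lambda>\<xi>. c (F_map A \<xi>))"
    by (simp add: fun_eq_iff D_def c_def F_map_def complex_eq_iff)
  have dF: "F_map A differentiable (at \<xi>)" if "\<xi> \<in> \<Omega>" for \<xi>
    by (simp add: Adiff differentiable_F_map that)
  have "(F_map A has_derivative (\<lambda>h. J *v h)) (at \<xi>\<^sub>0)"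
    using dF[OF gcp(1)] by (simp add: jacobian_works J_def)
  then have derD: "(D has_derivative L) (at \<xi>\<^sub>0)"
    unfolding cF L_def using lin_c
    by (intro bounded_linear.has_derivative[of c]) (auto simp: linear_linear)
  have "bij (\<lambda>h. J *v h)"
    using gcp(3) by (simp add: invertible_eq_bij)
  then have bij_L: "bij L"
    using bij_comp[OF _ bij_c] by (auto simp: L_def comp_def)
  have lin_L: "linear L"
    using derD by (rule has_derivative_linear)
  have contD: "continuous_on \<Omega> D"
    unfolding cF using lin_c dF
    by (intro linear_continuous_on_compose[of _ _ c] differentiable_imp_continuous_on)
      (auto simp: differentiable_on_def intro: differentiable_at_withinI)
  have D0: "D \<xi> = 0 \<longleftrightarrow> \<xi> = \<xi>\<^sub>0" if "\<xi> \<in> \<Omega>" for \<xi>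
  proof
    assume "D \<xi> = 0"
    show "\<xi> = \<xi>\<^sub>0"
    proof (rule ccontr)
      assume "\<xi> \<noteq> \<xi>\<^sub>0"
      then obtain \<mu> \<nu> where "eigenvalues (A \<xi>) = {\<mu>, \<nu>}" "\<mu> \<noteq> \<nu>"
        using assms(6) \<open>\<xi> \<in> \<Omega>\<close> by (metis DiffI card_2_iff singletonD)
      then show False
        using Delta_eq_eigenvalue_diff_sq[of "A \<xi>" \<mu> \<nu>] \<open>D \<xi> = 0\<close> by (simp add: D_def)
    qed
  next
    assume "\<xi> = \<xi>\<^sub>0"
    then show "D \<xi> = 0"
      using gcp(2) linear_0[OF lin_c] by (simp add: cF)
  qed
  obtain s where s: "continuous_on \<Omega> s" "\<And>\<xi>. \<xi> \<in> \<Omega> \<Longrightarrow> s \<xi> \<noteq> 0"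
    "\<And>\<xi>. \<xi> \<in> \<Omega> \<Longrightarrow> D \<xi> = (s \<xi>)\<^sup>2 * L (\<xi> - \<xi>\<^sub>0)"
    using sqrt_of_quotient_by_linearization[OF assms(2,3) gcp(1) contD derD bij_is_inj[OF bij_L] D0]
    by blast

  have per: "\<gamma> (t + 1) = \<gamma> t" for t
    using assms(7) by (simp add: jordan_curve_def periodic_with_def)
  have \<gamma>_cont: "continuous_on UNIV \<gamma>"
    using assms(7) by (simp add: jordan_curve_def)
  have \<gamma>_in: "\<gamma> t \<in> \<Omega>" for t
    using jordan_curve_image(1)[OF assms(7)] assms(8) by blast
  have \<gamma>_ne: "\<gamma> t \<noteq> \<xi>\<^sub>0" for t
    using jordan_curve_image(1)[OF assms(7), of t] assms(9) by (auto simp: encircles_def inside_def)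
  have lam_ne: "lam1 t \<noteq> lam2 t" for t
  proof
    assume "lam1 t = lam2 t"
    then show False
      using assms(6,13) \<gamma>_in[of t] \<gamma>_ne[of t] by (metis DiffI card_2_iff doubleton_eq_iff singletonD)
  qed
  define g where "g t = lam1 t - lam2 t" for t
  have g_ne: "g t \<noteq> 0" for t
    using lam_ne by (simp add: g_def)
  have g_cont: "continuous_on UNIV g"
    unfolding g_def by (intro continuous_intros assms)
  have gD: "D (\<gamma> t) = (g t)\<^sup>2" for t
    using Delta_eq_eigenvalue_diff_sq assms(13) lam_ne by (simp add: D_def g_def)

  \<comment> \<open>Dividing \<open>D (\<gamma> t) = (g t)\<^sup>2\<close> by the square of
    \<open>s (\<gamma> t)\<close> leaves this affine image of the curve, with square root
    \<open>g t / s (\<gamma> t)\<close>.\<close>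
  define p where "p t = L (\<gamma> t - \<xi>\<^sub>0)" for t
  have "simple_path p"
  proof -
    have "simple_path (L \<circ> ((+) (- \<xi>\<^sub>0) \<circ> \<gamma>))"
      by (simp add: simple_path_linear_image_eq simple_path_translation_eq lin_L bij_is_inj[OF bij_L]
          jordan_curve_simple_path assms(7))
    then show ?thesis
      by (simp add: p_def[abs_def] comp_def)
  qed
  moreover have "0 \<in> inside (path_image p)"
  proof -
    have "\<xi>\<^sub>0 \<in> inside (path_image \<gamma>)"
      using assms(9) jordan_curve_image(2)[OF assms(7)] by (simp add: encircles_def)
    obtain L' where L': "linear L'" "\<And>v. L' (L v) = v" "\<And>w. L (L' w) = w"
      using linear_injective_left_inverse[OF lin_L bij_is_inj[OF bij_L]] bij_is_surj[OF bij_L]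
      by (metis comp_apply id_apply surj_def)
    have "homeomorphism UNIV UNIV (\<lambda>v. L (v - \<xi>\<^sub>0)) (\<lambda>w. L' w + \<xi>\<^sub>0)"
    proof (rule homeomorphismI)
      show "continuous_on UNIV (\<lambda>v. L (v - \<xi>\<^sub>0))"
        by (rule linear_continuous_on_compose[OF _ lin_L]) (intro continuous_intros)
      show "continuous_on UNIV (\<lambda>w. L' w + \<xi>\<^sub>0)"
        by (intro continuous_on_add continuous_on_const linear_continuous_on_compose[OF continuous_on_id L'(1)])
    qed (simp_all add: L'(2,3))
    then have "L (\<xi>\<^sub>0 - \<xi>\<^sub>0) \<in> inside ((\<lambda>v. L (v - \<xi>\<^sub>0)) ` path_image \<gamma>)"
      using inside_homeomorphic_image \<open>\<xi>\<^sub>0 \<in> inside (path_image \<gamma>)\<close> by blast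
    then show ?thesis
      by (simp add: linear_0[OF lin_L] path_image_def p_def image_image)
  qed
  moreover have "continuous_on {0..1} (\<lambda>t. g t / s (\<gamma> t))"
    using \<gamma>_in s(2)
    by (intro continuous_intros continuous_on_compose2[OF s(1)] continuous_on_subset[OF g_cont]
        continuous_on_subset[OF \<gamma>_cont]) auto
  moreover have "p t = (g t / s (\<gamma> t))\<^sup>2" for t
    using s(2,3)[OF \<gamma>_in[of t]] gD[of t] by (simp add: p_def power_divide field_simps)
  ultimately have "g 1 / s (\<gamma> 1) = - (g 0 / s (\<gamma> 0))"
    by (rule sqrt_along_jordan_curve_changes_sign)
  \<comment> \<open>The factor \<open>s\<close> lives on \<open>\<Omega>\<close> itself, so it
    returns to its value when the curve closes; the sign change belongs to \<open>g\<close>.\<close>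
  then have g1: "g 1 = - g 0"
    using per[of 0] s(2)[OF \<gamma>_in[of 0]] by (simp add: field_simps)

  \<comment> \<open>The sign is known at \<open>t = 0\<close>; continuity of this ratio with values
    in \<open>{1, -1}\<close> carries it to all \<open>t\<close>.\<close>
  define r where "r t = g (t + 1) / g t" for t
  have perm: "{lam1 (t + 1), lam2 (t + 1)} = {lam1 t, lam2 t}" for t
    using assms(13) per by metis
  have "g (t + 1) = g t \<or> g (t + 1) = - g t" for t
    using perm[of t] by (auto simp: g_def doubleton_eq_iff)
  then have "r t = 1 \<or> r t = -1" for t
    using g_ne[of t] by (metis divide_minus_left divide_self r_def)
  then have "range r \<subseteq> {1, -1}"
    by blast
  then have "finite (range r)"
    by (rule finite_subset) simp
  moreover have "continuous_on UNIV r"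
    unfolding r_def using g_ne
    by (intro continuous_intros continuous_on_compose2[OF g_cont] g_cont) auto
  ultimately have "r constant_on UNIV"
    by (intro continuous_finite_range_constant) auto
  then have "r t = r 0" for t
    by (auto simp: constant_on_def)
  moreover have "r 0 = -1"
    using g1 g_ne[of 0] by (simp add: r_def)
  ultimately have g_shift: "g (t + 1) = - g t" for t
    using g_ne[of t] by (metis divide_minus_left divide_self divide_cancel_right r_def)
  show ?thesis
  proof
    fix t
    show "lam1 (t + 1) = lam2 t \<and> lam2 (t + 1) = lam1 t"
      \<comment> \<open>If the labels were kept, \<open>g (t + 1)\<close> would equal both
        \<open>g t\<close> and \<open>- g t\<close>, against \<open>lam_ne\<close>.\<close>
      using perm[of t] g_shift[of t] lam_ne[of t] by (auto simp: g_def doubleton_eq_iff)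
  qed
qed

end
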